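(* Suppose there exists a line segment $H$ with one end point in $F_l$ and the other in $F_r$, whose length equals the shortest distance between a point of $F_l$ and a point of $F_r$, and such that $H\subset F$. Then it is optimal to deploy the radars on $H$: among all deployments of the $M$ transmitters and $N$ receivers at points of $F$, the minimum of the value $B(P^* )$ is attained by a deployment with all transmitters and receivers on $H$. That is, for every deployment $\{T_i\}_{i=1}^M,\{R_j\}_{j=1}^N\subset F$ there exists a deployment $\{T_i'\}_{i=1}^M,\{R_j'\}_{j=1}^N\subset H$ whose value $B'({P^*}')$ satisfies $B'({P^*}')\le B(P^* )$.
   Context: The field $F\subset\mathbb{R}^2$ is a bounded connected (closed) region enclosed by four curves, which in cyclic order along its boundary are: the left boundary $F_l$, the entrance side, the right boundary $F_r$, and the destination side (so $F$ is a closed Jordan region whose boundary is divided into four consecutive arcs; the curves may otherwise be arbitrary). An intrusion path is a continuous curve $P\subset F$ from a point of the entrance side to a point of the destination side. A deployment consists of $M\ge 1$ transmitters located at points $T_1,\dots,T_M$ and $N\ge1$ receivers located at points $R_1,\dots,R_N$ (locations may coincide). $\|ab\|$ is the Euclidean distance. For a point $p$, $I(p)=\min_{i,j}\|T_ip\|\,\|R_jp\|$ (smaller $I$ means higher detectability). For an intrusion path $P$, $B(P)=\min_{p\in P}I(p)$. The value $B(P^* )$, called the worst-case intrusion detectability of the deployment, is the maximum (supremum) of $B(P)$ over all intrusion paths $P$; maximizing worst-case detectability means minimizing $B(P^* )$. Primes denote the same quantities for the deployment $\{T_i'\},\{R_j'\}$. *)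

theory Defs
  imports "HOL-Analysis.Analysis"
begin

text \<open>
  The plane is \<^typ>\<open>complex\<close>, whose \<^const>\<open>dist\<close> is the Euclidean distance; this is the
  type for which the library proves the Jordan curve theorem.
\<close>

text \<open>
  The four curves, in cyclic order left, entrance, right, destination, are consecutive
  nondegenerate arcs that together form a simple closed curve. Either orientation of the
  boundary is allowed.
\<close>

definition four_sided ::
  "(real \<Rightarrow> complex) \<Rightarrow> (real \<Rightarrow> complex) \<Rightarrow> (real \<Rightarrow> complex) \<Rightarrow> (real \<Rightarrow> complex) \<Rightarrow> bool"
  where
  "four_sided gl ge gr gd \<longleftrightarrow>
     arc gl \<and> arc ge \<and> arc gr \<and> arc gd \<and>
     pathfinish gl = pathstart ge \<and> pathfinish ge = pathstart gr \<and>
     pathfinish gr = pathstart gd \<and> pathfinish gd = pathstart gl \<and>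
     simple_path (gl +++ ge +++ gr +++ gd)"

definition region ::
  "(real \<Rightarrow> complex) \<Rightarrow> (real \<Rightarrow> complex) \<Rightarrow> (real \<Rightarrow> complex) \<Rightarrow> (real \<Rightarrow> complex) \<Rightarrow> complex set"
  where
  "region gl ge gr gd =
     (let C = path_image (gl +++ ge +++ gr +++ gd) in C \<union> inside C)"

definition intrusion_paths ::
  "complex set \<Rightarrow> complex set \<Rightarrow> complex set \<Rightarrow> (real \<Rightarrow> complex) set"
  where
  "intrusion_paths F E D =
     {P. path P \<and> path_image P \<subseteq> F \<and> pathstart P \<in> E \<and> pathfinish P \<in> D}"

text \<open>
  A deployment is a pair of location functions \<open>T\<close>, \<open>R\<close>, of which only the values at the indices
  \<open>1..M\<close> and \<open>1..N\<close> are used.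
\<close>

definition deployed_in ::
  "complex set \<Rightarrow> nat \<Rightarrow> nat \<Rightarrow> (nat \<Rightarrow> complex) \<Rightarrow> (nat \<Rightarrow> complex) \<Rightarrow> bool"
  where
  "deployed_in S M N T R \<longleftrightarrow> (\<forall>i\<in>{1..M}. T i \<in> S) \<and> (\<forall>j\<in>{1..N}. R j \<in> S)"

definition detect ::
  "nat \<Rightarrow> nat \<Rightarrow> (nat \<Rightarrow> complex) \<Rightarrow> (nat \<Rightarrow> complex) \<Rightarrow> complex \<Rightarrow> real"
  where
  "detect M N T R p =
     Min ((\<lambda>(i, j). dist (T i) p * dist (R j) p) ` ({1..M} \<times> {1..N}))"

text \<open>
  The infimum is a minimum, since the image of a path is compact and \<^const>\<open>detect\<close> is continuous.
\<close>

definition path_detect ::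
  "nat \<Rightarrow> nat \<Rightarrow> (nat \<Rightarrow> complex) \<Rightarrow> (nat \<Rightarrow> complex) \<Rightarrow> (real \<Rightarrow> complex) \<Rightarrow> real"
  where
  "path_detect M N T R P = (INF p\<in>path_image P. detect M N T R p)"

text \<open>
  For a region bounded by four arcs the supremum is over a nonempty set that is bounded above:
  the boundary contains an intrusion path, and the region is bounded.
\<close>

definition worst_case ::
  "complex set \<Rightarrow> complex set \<Rightarrow> complex set \<Rightarrow> nat \<Rightarrow> nat \<Rightarrow>
   (nat \<Rightarrow> complex) \<Rightarrow> (nat \<Rightarrow> complex) \<Rightarrow> real"
  where
  "worst_case F E D M N T R = (SUP P\<in>intrusion_paths F E D. path_detect M N T R P)"

end

theory Submission
  imports Defs
begin

text \<open>
  Let \<open>c\<close> be the value of a deployment. Every intrusion path contains a point where \<open>detect\<close> is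
  at most \<open>c\<close>, so by planar topology the set \<open>K\<close> of all such points blocks the region between the
  left and the right side. The function \<open>f p = min (dist a b) (infdist p Fl)\<close> is 1-Lipschitz,
  vanishes on \<open>Fl\<close> and equals \<open>dist a b\<close> on \<open>Fr\<close>. It takes every value \<open>s\<close> in between on \<open>K\<close>,
  as otherwise \<open>K\<close> would split into the disjoint compact parts \<open>f < s\<close> and \<open>f > s\<close>, the first
  missing \<open>Fr\<close> and the second missing \<open>Fl\<close>, and Janiszewski's theorem would give an intrusion path
  avoiding both. Moving each device \<open>p\<close> to the point of \<open>H\<close> at distance \<open>f p\<close> from \<open>a\<close>
  does not increase distances, so after the move \<open>detect\<close> is at most \<open>c\<close> on all of \<open>H\<close>. Every
  intrusion path crosses \<open>H\<close>, again by Janiszewski's theorem.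
\<close>

subsection \<open>Cutting one side of a Jordan curve\<close>

text \<open>
  \<open>U\<close> and \<open>W\<close> are the two sides of a Jordan curve \<open>C\<close>, and the continuum \<open>X\<close> runs within
  \<open>U \<union> C\<close> and meets both common points of the arcs \<open>J1\<close> and \<open>J2\<close> that make up \<open>C\<close>. Which
  side is bounded is left open: \<open>U\<close> is the interior when intrusion paths are shown to cross a
  segment, and the exterior when one is constructed.
\<close>

locale cut_region =
  fixes U W C J1 J2 X :: "complex set"
  assumes openU: "open U" and openW: "open W" and conW: "connected W"
    and UW: "U \<inter> W = {}" "U \<union> W = - C"
    and C_closure: "C \<subseteq> closure W"
    and compJ: "compact J1" "compact J2" and J: "J1 \<union> J2 = C"
    and compX: "compact X" and conX: "connected X" and X: "X \<inter> W = {}"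
    and JX: "J1 \<inter> J2 \<subseteq> X"
begin

text \<open>
  \<open>side K\<close> is the component of \<open>- (X \<union> K)\<close> containing \<open>W\<close>. So \<open>U \<inter> side J2\<close> is the part
  of \<open>U - X\<close> that is adjacent to \<open>J1\<close>, and vice versa.
\<close>

definition side :: "complex set \<Rightarrow> complex set" where
  "side K = {z. \<exists>w\<in>W. connected_component (- (X \<union> K)) w z}"

lemma open_side: "compact K \<Longrightarrow> open (side K)"
proof -
  assume "compact K"
  then have o: "open (- (X \<union> K))"
    using compX \<open>compact K\<close> by (intro open_Compl closed_Un compact_imp_closed)
  have "side K = (\<Union>w\<in>W. connected_component_set (- (X \<union> K)) w)"
    by (auto simp: side_def)
  then show ?thesis using open_connected_component[OF o] by auto
qed

lemma side_disjoint: "side K \<inter> (X \<union> K) = {}"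
  using connected_component_in by (fastforce simp: side_def)

lemma side_absorb:
  assumes "connected Q" "Q \<inter> (X \<union> K) = {}" "Q \<inter> side K \<noteq> {}"
  shows "Q \<subseteq> side K"
proof
  fix q assume "q \<in> Q"
  obtain z w where "z \<in> Q" "w \<in> W" and w: "connected_component (- (X \<union> K)) w z"
    using assms(3) by (auto simp: side_def)
  have "connected_component (- (X \<union> K)) z q"
    unfolding connected_component_def using assms \<open>q \<in> Q\<close> \<open>z \<in> Q\<close> by blast
  with w show "q \<in> side K"
    using \<open>w \<in> W\<close> connected_component_trans side_def by blast
qed

text \<open>The component of \<open>p\<close> in the open complement of \<open>X \<union> K\<close>
  is an open neighbourhood of \<open>p\<close>, so it meets \<open>W\<close>.\<close>

lemma side_contains:
  assumes "p \<in> closure W" "p \<notin> X \<union> K" "compact K"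
  shows "p \<in> side K"
proof -
  let ?Q = "connected_component_set (- (X \<union> K)) p"
  have "open ?Q"
    using compX assms by (intro open_connected_component open_Compl closed_Un compact_imp_closed)
  moreover have "p \<in> ?Q" using assms by simp
  ultimately obtain w where "w \<in> W" "w \<in> ?Q"
    using assms(1) by (meson closure_iff_nhds_not_empty disjoint_iff open_subset subset_refl)
  then show ?thesis by (auto simp: side_def intro: connected_component_sym)
qed

lemma side_C: "p \<in> J1 - X \<Longrightarrow> p \<in> side J2" "p \<in> J2 - X \<Longrightarrow> p \<in> side J1"
  using side_contains C_closure J JX compJ by blast+

lemma connected_component_W:
  assumes "z \<in> side K" "K \<inter> W = {}" "w \<in> W"
  shows "connected_component (- (X \<union> K)) z w"
proof -
  obtain w' where w': "w' \<in> W" "connected_component (- (X \<union> K)) w' z"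
    using assms by (auto simp: side_def)
  have "connected_component (- (X \<union> K)) w' w"
    unfolding connected_component_def using conW w'(1) assms X by blast
  with w' show ?thesis by (meson connected_component_sym connected_component_trans)
qed

text \<open>Janiszewski's theorem: \<open>X \<union> J1\<close> and \<open>X \<union> J2\<close>
  meet in the connected set \<open>X\<close>, so if neither separated some point of \<open>U\<close>
  from \<open>W\<close>, their union would not either, although it contains
  \<open>C\<close>.\<close>

lemma sides_disjoint: "U \<inter> side J1 \<inter> side J2 = {}"
proof (rule ccontr)
  assume "\<not> ?thesis"
  then obtain z where z: "z \<in> U" "z \<in> side J1" "z \<in> side J2" by auto
  then obtain w where w: "w \<in> W" by (auto simp: side_def)
  have JW: "J1 \<inter> W = {}" "J2 \<inter> W = {}" using J UW by auto
  have "(X \<union> J1) \<inter> (X \<union> J2) = X" using JX by auto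
  then have "connected_component (- ((X \<union> J1) \<union> (X \<union> J2))) z w"
    using Janiszewski[of "X \<union> J1" "X \<union> J2" z w] connected_component_W z w JW compX compJ conX
    by (simp only: compact_Un compact_imp_closed)
  then obtain Q where "connected Q" "Q \<subseteq> - C" "z \<in> Q" "w \<in> Q"
    unfolding connected_component_def using J by blast
  then show False
    using connectedD[of Q U W] openU openW UW z w by blast
qed

text \<open>A point of \<open>J1 - X\<close> in the closure of \<open>Q\<close> has the open set
  \<open>side J2\<close> as a neighbourhood, so \<open>Q\<close> meets \<open>side J2\<close> and
  lies in it. By symmetry it lies in \<open>side J1\<close>, against
  \<open>sides_disjoint\<close>.\<close>

lemma no_link:
  assumes Q: "connected Q" "Q \<subseteq> U - X" and "closure Q \<inter> (J1 - X) \<noteq> {}" "closure Q \<inter> (J2 - X) \<noteq> {}"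
  shows False
proof -
  have QJ: "Q \<inter> (X \<union> J1) = {}" "Q \<inter> (X \<union> J2) = {}"
    using Q UW J by auto
  have *: "Q \<inter> side J1 \<noteq> {}" "Q \<inter> side J2 \<noteq> {}"
    using assms side_C open_side compJ
    by (metis IntE Int_commute disjoint_iff open_Int_closure_eq_empty)+
  then have "Q \<subseteq> U \<inter> side J1 \<inter> side J2"
    using side_absorb[OF Q(1) QJ(1)] side_absorb[OF Q(1) QJ(2)] Q(2) by auto
  then show False
    using * sides_disjoint by blast
qed

text \<open>A component of \<open>- (X \<union> C)\<close> within \<open>U\<close> that met neither
  side would have its whole frontier on \<open>X\<close>, so \<open>X\<close> would separate it from
  \<open>W\<close>.\<close>

lemma sides_cover:
  assumes "connected (- X)" "W \<noteq> {}"
  shows "U - X \<subseteq> side J1 \<union> side J2"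
proof
  fix z assume z: "z \<in> U - X"
  let ?Q = "connected_component_set (- (X \<union> C)) z"
  have QJ: "?Q \<inter> (X \<union> C) = {}" using connected_component_in by fastforce
  have zQ: "z \<in> ?Q" using z UW by auto
  show "z \<in> side J1 \<union> side J2"
  proof (rule ccontr)
    assume "z \<notin> side J1 \<union> side J2"
    moreover have "connected ?Q" "?Q \<inter> (X \<union> J1) = {}" "?Q \<inter> (X \<union> J2) = {}" using QJ J by auto
    ultimately have "?Q \<inter> side J1 = {}" "?Q \<inter> side J2 = {}"
      using side_absorb[of ?Q] zQ by blast+
    then have "closure ?Q \<inter> side J1 = {}" "closure ?Q \<inter> side J2 = {}"
      using open_side compJ by (metis Int_commute open_Int_closure_eq_empty)+
    then have "closure ?Q \<inter> C \<subseteq> X" using side_C J by blast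
    have "closed (X \<union> C)"
      using compX compJ J by (metis closed_Un compact_imp_closed)
    have "frontier ?Q \<subseteq> X \<union> C"
      using frontier_of_connected_component_subset[of "- (X \<union> C)" z] \<open>closed (X \<union> C)\<close>
      by (metis frontier_complement frontier_subset_eq subset_trans)
    then have "frontier ?Q \<subseteq> X"
      using \<open>closure ?Q \<inter> C \<subseteq> X\<close> by (auto simp: frontier_def)
    obtain w where w: "w \<in> W" using assms by auto
    have "w \<notin> ?Q"
    proof
      assume "w \<in> ?Q"
      then obtain R where "connected R" "R \<subseteq> - C" "z \<in> R" "w \<in> R"
        unfolding connected_component_def by blast
      then show False
        using connectedD[of R U W] openU openW UW z w by blast
    qed
    then show False
      using connected_Int_frontier[OF assms(1), of ?Q] \<open>frontier ?Q \<subseteq> X\<close> z zQ w X by blast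
  qed
qed

text \<open>Two points of the set are joined off \<open>X \<union> K\<close> by way of
  \<open>W\<close>, and off \<open>C\<close> within \<open>U\<close>. As \<open>X \<union> K\<close>
  meets \<open>C\<close> exactly in the connected set \<open>K\<close>, Janiszewski's theorem joins
  them off both.\<close>

lemma connected_side:
  assumes "connected U" "W \<noteq> {}" "compact K" "connected K" "X \<inter> C \<subseteq> K" "K \<subseteq> C"
  shows "connected (U \<inter> side K)"
  unfolding connected_iff_connected_component
proof (intro ballI)
  fix z z' assume z: "z \<in> U \<inter> side K" "z' \<in> U \<inter> side K"
  obtain w where w: "w \<in> W" using assms by auto
  have KW: "K \<inter> W = {}" using assms UW by auto
  have "compact C" using compJ J compact_Un by blast
  have "(X \<union> K) \<inter> C = K" using assms by auto
  have 1: "connected_component (- (X \<union> K)) z z'"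
    using connected_component_W[OF _ KW w] z
    by (meson IntD2 connected_component_sym connected_component_trans)
  have 2: "connected_component (- C) z z'"
    unfolding connected_component_def using assms(1) z UW by blast
  have "connected_component (- ((X \<union> K) \<union> C)) z z'"
  proof (rule Janiszewski)
    show "connected ((X \<union> K) \<inter> C)" using \<open>(X \<union> K) \<inter> C = K\<close> assms by simp
  qed (use 1 2 assms compX \<open>compact C\<close> in \<open>simp_all only: compact_Un compact_imp_closed\<close>)
  then obtain Q where Q: "connected Q" "Q \<subseteq> - ((X \<union> K) \<union> C)" "z \<in> Q" "z' \<in> Q"
    unfolding connected_component_def by blast
  have "Q \<subseteq> U"
    using connectedD[of Q U W] openU openW UW Q z by blast
  moreover have "Q \<subseteq> side K"
    using side_absorb[of Q K] Q z by blast
  ultimately show "connected_component (U \<inter> side K) z z'"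
    unfolding connected_component_def using Q by blast
qed

end

text \<open>\<open>s\<close> is the last time in \<open>A\<close> and \<open>t\<close> the first
  later time in \<open>B\<close>. The last conclusion makes the end points limits of the open piece
  between them.\<close>

lemma path_last_first:
  fixes g :: "real \<Rightarrow> 'a::metric_space"
  assumes "path g" "closed A" "closed B" "pathstart g \<in> A" "pathfinish g \<in> B"
    and AB: "path_image g \<inter> A \<inter> B = {}"
  obtains s t where "0 \<le> s" "s < t" "t \<le> 1" "g s \<in> A" "g t \<in> B"
    "g ` {s<..<t} \<inter> (A \<union> B) = {}" "connected (g ` {s<..<t})"
    "g ` {s..t} \<subseteq> closure (g ` {s<..<t})"
proof -
  have cont: "continuous_on {0..1} g" using assms by (simp add: path_def)
  define SA where "SA = {0..1} \<inter> g -` A"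
  have cSA: "compact SA" unfolding SA_def
    using continuous_closed_preimage[OF cont _ assms(2)]
    by (auto simp: compact_eq_bounded_closed intro: bounded_subset[OF bounded_closed_interval])
  have "0 \<in> SA" using assms by (auto simp: SA_def pathstart_def)
  then obtain s where s: "s \<in> SA" "\<And>r. r \<in> SA \<Longrightarrow> r \<le> s"
    using compact_attains_sup[OF cSA] by blast
  then have s01: "0 \<le> s" "s \<le> 1" "g s \<in> A" by (auto simp: SA_def)
  have "continuous_on {s..1} g"
    using cont s01 continuous_on_subset by fastforce
  define SB where "SB = {s..1} \<inter> g -` B"
  have cSB: "compact SB" unfolding SB_def
    using continuous_closed_preimage[OF \<open>continuous_on {s..1} g\<close> _ assms(3)]
    by (auto simp: compact_eq_bounded_closed intro: bounded_subset[OF bounded_closed_interval])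
  have "1 \<in> SB" using assms s01 by (auto simp: SB_def pathfinish_def)
  then obtain t where t: "t \<in> SB" "\<And>r. r \<in> SB \<Longrightarrow> t \<le> r"
    using compact_attains_inf[OF cSB] by blast
  then have t01: "s \<le> t" "t \<le> 1" "g t \<in> B" by (auto simp: SB_def)
  have "g s \<in> path_image g" using s01 by (auto simp: path_image_def)
  then have "s \<noteq> t" using AB s01 t01 by blast
  then have "s < t" using t01 by simp
  have cst: "continuous_on {s..t} g"
    using cont s01 t01 continuous_on_subset by fastforce
  show thesis
  proof
    have "g r \<notin> A \<union> B" if "r \<in> {s<..<t}" for r
      using s(2)[of r] t(2)[of r] s01 t01 that by (auto simp: SA_def SB_def)
    then show "g ` {s<..<t} \<inter> (A \<union> B) = {}" by blast
    show "connected (g ` {s<..<t})"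
      by (rule connected_continuous_image[OF continuous_on_subset[OF cst]]) auto
    show "g ` {s..t} \<subseteq> closure (g ` {s<..<t})"
      using continuous_image_closure_subset[OF cst, of "{s<..<t}"] \<open>s < t\<close>
      by (auto simp: closure_greaterThanLessThan)
  qed (use s01 t01 \<open>s < t\<close> in auto)
qed

text \<open>A path missing \<open>X\<close> would have, between \<open>J1\<close> and
  \<open>J2\<close>, a piece within \<open>U - X\<close> whose closure reaches both arcs, against
  \<open>no_link\<close>.\<close>

lemma (in cut_region) crossing:
  assumes "path g" "path_image g \<subseteq> U \<union> C" "pathstart g \<in> J1" "pathfinish g \<in> J2"
  shows "path_image g \<inter> X \<noteq> {}"
proof
  assume gX: "path_image g \<inter> X = {}"
  obtain s t where st: "0 \<le> s" "s < t" "t \<le> 1" "g s \<in> J1" "g t \<in> J2"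
    "g ` {s<..<t} \<inter> (J1 \<union> J2) = {}" "connected (g ` {s<..<t})"
    "g ` {s..t} \<subseteq> closure (g ` {s<..<t})"
    using path_last_first[of g J1 J2] assms gX JX compJ compact_imp_closed by blast
  have im: "g ` {s<..<t} \<subseteq> path_image g" "g s \<in> path_image g" "g t \<in> path_image g"
    using st by (auto simp: path_image_def)
  have "g ` {s<..<t} \<subseteq> U - X" using im assms st(6) J gX by blast
  moreover have "g s \<in> closure (g ` {s<..<t})" "g t \<in> closure (g ` {s<..<t})"
    using st by auto
  ultimately show False using no_link[OF st(7)] st gX im by blast
qed

subsection \<open>Regions with four sides\<close>

text \<open>The last two facts serve when an arc is cut at a corner of the region.\<close>

lemma arc_initial_final_segments:
  fixes g :: "real \<Rightarrow> 'a::topological_space"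
  assumes "arc g" "u \<in> {0..1}"
  shows "g ` {0..u} \<inter> g ` {u..1} = {g u}" "g ` {0..u} \<union> g ` {u..1} = path_image g"
    "pathstart g \<in> g ` {u..1} \<Longrightarrow> u = 0" "pathfinish g \<in> g ` {0..u} \<Longrightarrow> u = 1"
proof -
  have inj: "inj_on g {0..1}" using assms by (simp add: arc_def)
  have "g ` ({0..u} \<inter> {u..1}) = g ` {0..u} \<inter> g ` {u..1}"
    using assms by (intro inj_on_image_Int[OF inj]) auto
  moreover have "{0..u} \<inter> {u..1} = {u}" using assms by auto
  ultimately show "g ` {0..u} \<inter> g ` {u..1} = {g u}" by simp
  have "{0..u} \<union> {u..1} = {0..1}" using assms by auto
  then show "g ` {0..u} \<union> g ` {u..1} = path_image g" by (metis image_Un path_image_def)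
  show "u = 0" if "pathstart g \<in> g ` {u..1}"
  proof -
    from that obtain r where "r \<in> {u..1}" "g 0 = g r" by (auto simp: pathstart_def)
    then show ?thesis using inj_onD[OF inj, of 0 r] assms by auto
  qed
  show "u = 1" if "pathfinish g \<in> g ` {0..u}"
  proof -
    from that obtain r where "r \<in> {0..u}" "g 1 = g r" by (auto simp: pathfinish_def)
    then show ?thesis using inj_onD[OF inj, of 1 r] assms by auto
  qed
qed

locale four_sided_region =
  fixes gl ge gr gd :: "real \<Rightarrow> complex"
  assumes four_sided: "four_sided gl ge gr gd"
begin

abbreviation "Fl \<equiv> path_image gl"
abbreviation "Fe \<equiv> path_image ge"
abbreviation "Fr \<equiv> path_image gr"
abbreviation "Fd \<equiv> path_image gd"
abbreviation "F \<equiv> region gl ge gr gd"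

definition C where "C = path_image (gl +++ ge +++ gr +++ gd)"

lemma arcs: "arc gl" "arc ge" "arc gr" "arc gd"
  and corners: "pathstart ge = pathfinish gl" "pathstart gr = pathfinish ge"
    "pathstart gd = pathfinish gr" "pathstart gl = pathfinish gd"
  and loop: "simple_path (gl +++ ge +++ gr +++ gd)"
    "pathfinish (gl +++ ge +++ gr +++ gd) = pathstart (gl +++ ge +++ gr +++ gd)"
  using four_sided by (auto simp: four_sided_def)

lemma C_sides: "C = Fl \<union> Fe \<union> Fr \<union> Fd"
  unfolding C_def using corners by (simp add: path_image_join Un_assoc)

lemma compact_sides: "compact Fl" "compact Fe" "compact Fr" "compact Fd"
  using arcs by (auto intro: compact_arc_image)

text \<open>A corner lying on an opposite side would force some arc to start and end at the same
  point. With opposite sides disjoint, neighbours share only their common corner.\<close>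

lemma sides_Int:
  "Fl \<inter> Fr = {}" "Fe \<inter> Fd = {}" "Fl \<inter> Fe \<subseteq> {pathfinish gl}" "Fl \<inter> Fd \<subseteq> {pathstart gl}"
  "Fe \<inter> Fr \<subseteq> {pathstart gr}" "Fr \<inter> Fd \<subseteq> {pathfinish gr}"
proof -
  have "arc (ge +++ gr +++ gd)"
    and l: "Fl \<inter> path_image (ge +++ gr +++ gd) \<subseteq> {pathstart gl, pathfinish gl}"
    using loop corners by (auto simp: simple_path_join_loop_eq)
  then have e: "Fe \<inter> path_image (gr +++ gd) \<subseteq> {pathstart gr}" and "arc (gr +++ gd)"
    using corners by (auto simp: arc_join_eq)
  then have r: "Fr \<inter> Fd \<subseteq> {pathfinish gr}"
    using corners by (auto simp: arc_join_eq)
  have l: "Fl \<inter> (Fe \<union> Fr \<union> Fd) \<subseteq> {pathstart gl, pathfinish gl}"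
    using l corners by (auto simp: path_image_join)
  have e: "Fe \<inter> (Fr \<union> Fd) \<subseteq> {pathstart gr}"
    using e corners by (auto simp: path_image_join)
  have ends: "pathstart g \<noteq> pathfinish g" if "arc g" for g :: "real \<Rightarrow> complex"
    using arc_distinct_ends that by metis
  note ne = ends[OF arcs(1)] ends[OF arcs(2)] ends[OF arcs(3)] ends[OF arcs(4)]
  note inim = pathstart_in_path_image pathfinish_in_path_image
  have in1: "pathfinish gl \<in> Fe" "pathstart gl \<in> Fd" "pathstart gr \<in> Fr" "pathstart gr \<in> Fe" "pathstart gd \<in> Fr"
    using corners inim by metis+
  have "pathfinish gl \<notin> Fr"
  proof
    assume "pathfinish gl \<in> Fr"
    then have "pathfinish gl = pathstart gr" using e in1(1) by auto
    then show False using ne(2) corners by simp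
  qed
  moreover have "pathstart gl \<notin> Fr"
  proof
    assume "pathstart gl \<in> Fr"
    then have "pathstart gl = pathfinish gr" using r in1(2) by auto
    then show False using ne(4) corners by simp
  qed
  ultimately show lr: "Fl \<inter> Fr = {}" using l by auto
  have "pathstart gr \<notin> Fd"
  proof
    assume "pathstart gr \<in> Fd"
    then have "pathstart gr = pathfinish gr" using r in1(3) by auto
    then show False using ne(3) by simp
  qed
  then show ed: "Fe \<inter> Fd = {}" using e by auto
  show "Fr \<inter> Fd \<subseteq> {pathfinish gr}" using r .
  show "Fe \<inter> Fr \<subseteq> {pathstart gr}" using e by auto
  show "Fl \<inter> Fe \<subseteq> {pathfinish gl}" using l ed in1(2) by auto
  show "Fl \<inter> Fd \<subseteq> {pathstart gl}" using l ed in1(1) by auto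
qed

lemma F_eq: "F = C \<union> inside C"
  by (simp add: region_def C_def Let_def)

lemma Jordan:
  "open (inside C)" "connected (inside C)" "inside C \<noteq> {}"
  "open (outside C)" "connected (outside C)" "outside C \<noteq> {}"
  "bounded (inside C)" "inside C \<inter> outside C = {}" "inside C \<union> outside C = - C"
  "frontier (inside C) = C" "frontier (outside C) = C"
  using Jordan_inside_outside[OF loop] unfolding C_def by auto

lemma F_outside: "F = - outside C"
  using Jordan(8,9) unfolding F_eq by blast

lemma compact_F: "compact F"
proof -
  have "compact C" using compact_sides C_sides by auto
  then have "bounded F" unfolding F_eq using Jordan compact_imp_bounded by simp
  then show ?thesis using Jordan F_outside compact_eq_bounded_closed by (metis closed_Compl)
qed

text \<open>Each of \<open>Fl\<close> and \<open>Fr\<close> is cut in two and gives one segment to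
  each half of \<open>C\<close>. If a cut point is a corner, one of the segments is a single
  point.\<close>

lemma split_boundary:
  assumes "a \<in> Fl" "b \<in> Fr"
  obtains J1 J2 where "compact J1" "compact J2" "connected J1" "connected J2"
    "J1 \<union> J2 = C" "J1 \<inter> J2 = {a, b}" "Fe \<subseteq> J1" "Fd \<subseteq> J2"
proof -
  obtain u where u: "u \<in> {0..1}" "a = gl u" using assms by (auto simp: path_image_def)
  obtain v where v: "v \<in> {0..1}" "b = gr v" using assms by (auto simp: path_image_def)
  note lu = arc_initial_final_segments[OF arcs(1) u(1)]
  note rv = arc_initial_final_segments[OF arcs(3) v(1)]
  note inim = pathstart_in_path_image pathfinish_in_path_image
  have piece: "compact (g ` {r..s})" "connected (g ` {r..s})" if "arc g" "{r..s} \<subseteq> {0..1}"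
    for g :: "real \<Rightarrow> complex" and r s
  proof -
    have "continuous_on {r..s} g" using that arc_imp_path path_def continuous_on_subset by blast
    then show "compact (g ` {r..s})" "connected (g ` {r..s})"
      by (auto intro: compact_continuous_image connected_continuous_image)
  qed
  have uv: "{0..u} \<subseteq> {0..1}" "{u..1} \<subseteq> {0..1}" "{0..v} \<subseteq> {0..1}" "{v..1} \<subseteq> {0..1}" using u v by auto
  note pc = piece[OF arcs(1) uv(1)] piece[OF arcs(1) uv(2)] piece[OF arcs(3) uv(3)] piece[OF arcs(3) uv(4)]
  define J1 where "J1 = gl ` {u..1} \<union> Fe \<union> gr ` {0..v}"
  define J2 where "J2 = gr ` {v..1} \<union> Fd \<union> gl ` {0..u}"
  have mem: "pathfinish gl \<in> gl ` {u..1}" "pathstart gl \<in> gl ` {0..u}"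
    "pathfinish gr \<in> gr ` {v..1}" "pathstart gr \<in> gr ` {0..v}"
    using u v by (auto simp: pathfinish_def pathstart_def)
  have memE: "pathfinish gl \<in> Fe" "pathstart gr \<in> Fe" "pathfinish gr \<in> Fd" "pathstart gl \<in> Fd"
    using corners inim by metis+
  show thesis
  proof
    show "compact J1" "compact J2" unfolding J1_def J2_def
      using pc compact_sides by auto
    have "connected (gl ` {u..1} \<union> Fe)"
      using mem memE pc arcs by (intro connected_Un) (auto intro: connected_arc_image)
    then show "connected J1" unfolding J1_def
      by (rule connected_Un) (use mem memE pc in auto)
    have "connected (gr ` {v..1} \<union> Fd)"
      using mem memE pc arcs by (intro connected_Un) (auto intro: connected_arc_image)
    then show "connected J2" unfolding J2_def
      by (rule connected_Un) (use mem memE pc in auto)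
    show "J1 \<union> J2 = C" using lu(2) rv(2) by (auto simp: J1_def J2_def C_sides)
    have sub: "gl ` {0..u} \<subseteq> Fl" "gl ` {u..1} \<subseteq> Fl" "gr ` {0..v} \<subseteq> Fr" "gr ` {v..1} \<subseteq> Fr"
      using lu(2) rv(2) by auto
    have ends: "pathstart gl \<in> gl ` {u..1} \<Longrightarrow> pathstart gl = a"
      "pathfinish gl \<in> gl ` {0..u} \<Longrightarrow> pathfinish gl = a"
      "pathstart gr \<in> gr ` {v..1} \<Longrightarrow> pathstart gr = b"
      "pathfinish gr \<in> gr ` {0..v} \<Longrightarrow> pathfinish gr = b"
      using lu(3,4) rv(3,4) u v by (metis pathstart_def pathfinish_def)+
    \<comment> \<open>A segment \<open>A\<close> of a side \<open>S\<close> can meet the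
      neighbouring side \<open>B\<close> only at the corner \<open>p\<close>, and \<open>p\<close>
      is on \<open>A\<close> only if it is the cut point \<open>c\<close>.\<close>
    have meet: "A \<inter> B \<subseteq> {c}" if "A \<subseteq> S" "S \<inter> B \<subseteq> {p}" "p \<in> A \<Longrightarrow> p = c" for A B S and p c :: complex
    proof
      fix z assume "z \<in> A \<inter> B"
      then have "z = p" "z \<in> A" using that(1,2) by auto
      then show "z \<in> {c}" using that(3) by simp
    qed
    have "Fr \<inter> Fe \<subseteq> {pathstart gr}" using sides_Int(5) by (simp add: Int_commute)
    note m = meet[OF sub(2) sides_Int(4) ends(1)] meet[OF sub(4) this ends(3)]
      meet[OF sub(1) sides_Int(3) ends(2)] meet[OF sub(3) sides_Int(6) ends(4)]
    have disj: "gl ` {0..u} \<inter> gr ` {0..v} = {}" "gl ` {u..1} \<inter> gr ` {v..1} = {}"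
      using sides_Int(1) sub by blast+
    \<comment> \<open>Distributing the intersection gives nine pieces, one for each premise.\<close>
    have "(A \<union> E \<union> B') \<inter> (B \<union> D \<union> A') = {a, b}"
      if "A \<inter> D \<subseteq> {a}" "B \<inter> E \<subseteq> {b}" "A' \<inter> E \<subseteq> {a}" "B' \<inter> D \<subseteq> {b}"
        "A' \<inter> B' = {}" "A \<inter> B = {}" "E \<inter> D = {}" "A' \<inter> A = {a}" "B' \<inter> B = {b}" for A A' B B' D E
      using that by fast
    from this[OF m disj sides_Int(2) lu(1)[folded u(2)] rv(1)[folded v(2)]]
    show "J1 \<inter> J2 = {a, b}" unfolding J1_def J2_def .
    show "Fe \<subseteq> J1" "Fd \<subseteq> J2" unfolding J1_def J2_def by blast+
  qed
qed

text \<open>Here the interior is the side that is cut: \<open>X\<close> contains both points at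
  which the boundary is split into a half with \<open>Fe\<close> and a half with
  \<open>Fd\<close>.\<close>

lemma crossing_continuum:
  assumes "a \<in> Fl" "b \<in> Fr" "compact X" "connected X" "a \<in> X" "b \<in> X" "X \<subseteq> F"
    and P: "P \<in> intrusion_paths F Fe Fd"
  shows "path_image P \<inter> X \<noteq> {}"
proof -
  obtain J1 J2 where bd: "compact J1" "compact J2"
    "J1 \<union> J2 = C" "J1 \<inter> J2 = {a, b}" "Fe \<subseteq> J1" "Fd \<subseteq> J2"
    using split_boundary[OF assms(1,2)] by metis
  interpret cut_region "inside C" "outside C" C J1 J2 X
  proof
    show "C \<subseteq> closure (outside C)" using Jordan by (auto simp: frontier_def)
  qed (use bd Jordan assms F_outside in auto)
  show ?thesis
    using crossing[of P] P bd(5,6) F_eq unfolding intrusion_paths_def by blast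
qed

text \<open>
  An arc \<open>X\<close> in the exterior joins \<open>Fl\<close> to \<open>Fr\<close> and splits the exterior into a part \<open>Oe\<close> at
  \<open>Fe\<close> and a part \<open>Od\<close> at \<open>Fd\<close>. Adding one half of \<open>X\<close> to each of \<open>Fl \<union> K1\<close> and
  \<open>Fr \<union> K2\<close> gives sets with a single common point. The first does not separate \<open>Oe\<close> from
  \<open>Od\<close>, because it misses \<open>Fr\<close>, and the second does not because it misses \<open>Fl\<close>. By
  Janiszewski's theorem some path joins \<open>Oe\<close> to \<open>Od\<close> and misses both sets. It can only
  leave \<open>Oe\<close> through \<open>Fe\<close> and enter \<open>Od\<close> through \<open>Fd\<close>, so it passes through the region.
\<close>

lemma path_avoiding:
  assumes K: "compact K1" "compact K2" "K1 \<subseteq> F" "K2 \<subseteq> F" "K1 \<inter> K2 = {}"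
    and KF: "K1 \<inter> Fr = {}" "K2 \<inter> Fl = {}"
  obtains P where "P \<in> intrusion_paths F Fe Fd" "path_image P \<inter> (K1 \<union> K2) = {}"
proof -
  let ?O = "outside C" and ?I = "inside C"
  have open_side_part: "openin (top_of_set (frontier ?O)) (C - S)" if "compact S" for S
    using Jordan(11) that by (metis Diff_eq Int_commute compact_imp_closed open_Compl openin_open_Int)
  have interior: "g (1/2) \<noteq> pathstart g" "g (1/2) \<noteq> pathfinish g" "g (1/2) \<in> path_image g" if "arc g" for g :: "real \<Rightarrow> complex"
    using that inj_onD[of g "{0..1}" "1/2" 0] inj_onD[of g "{0..1}" "1/2" 1]
    by (auto simp: arc_def pathstart_def pathfinish_def path_image_def)
  \<comment> \<open>The midpoints of \<open>gl\<close> and \<open>gr\<close> are not corners, so the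
    two relatively open parts of the frontier are nonempty and distinct. Accessible points in them
    can then be joined by an arc through the exterior.\<close>
  have "gl (1/2) \<in> C - (Fe \<union> Fr \<union> Fd)"
    using sides_Int interior[OF arcs(1)] by (auto simp: C_sides)
  moreover have "gr (1/2) \<in> C - (Fl \<union> Fe \<union> Fd)"
    using sides_Int interior[OF arcs(3)] by (auto simp: C_sides)
  moreover have "C - (Fe \<union> Fr \<union> Fd) \<noteq> C - (Fl \<union> Fe \<union> Fd)"
    using \<open>gl (1/2) \<in> C - (Fe \<union> Fr \<union> Fd)\<close> by (auto simp: C_sides)
  ultimately obtain g where g: "arc g" "pathstart g \<in> C - (Fe \<union> Fr \<union> Fd)"
      "pathfinish g \<in> C - (Fl \<union> Fe \<union> Fd)" "g ` {0<..<1} \<subseteq> ?O"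
    using dense_accessible_frontier_point_pairs[OF Jordan(4,5) open_side_part open_side_part,
        of "Fe \<union> Fr \<union> Fd" "Fl \<union> Fe \<union> Fd"] compact_sides by blast
  define X where "X = path_image g"
  have a: "g 0 \<in> Fl" "g 0 \<notin> Fe \<union> Fr \<union> Fd" and b: "g 1 \<in> Fr" "g 1 \<notin> Fl \<union> Fe \<union> Fd"
    using g C_sides by (auto simp: pathstart_def pathfinish_def)
  have gF: "r = 0 \<or> r = 1" if "g r \<in> F" "r \<in> {0..1}" for r
  proof (rule ccontr)
    assume "\<not> ?thesis"
    then have "r \<in> {0<..<1}" using that by auto
    then have "g r \<in> ?O" using g(4) by blast
    then show False using that F_outside by auto
  qed
  have XF: "X \<inter> F \<subseteq> {g 0, g 1}" using gF by (auto simp: X_def path_image_def) blast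
  have gX: "compact X" "connected X" "connected (- X)" unfolding X_def
    using g by (auto intro: compact_arc_image connected_arc_image connected_arc_complement)
  obtain J1 J2 where bd: "compact J1" "compact J2" "connected J1" "connected J2"
    "J1 \<union> J2 = C" "J1 \<inter> J2 = {g 0, g 1}" "Fe \<subseteq> J1" "Fd \<subseteq> J2"
    using split_boundary[OF a(1) b(1)] by metis
  have aX: "g 0 \<in> X" "g 1 \<in> X" by (auto simp: X_def path_image_def)
  interpret cut_region ?O ?I C J1 J2 X
  proof
    show "C \<subseteq> closure ?I" using Jordan by (auto simp: frontier_def)
    have "g 0 \<in> C" "g 1 \<in> C" using g(2,3) by (auto simp: pathstart_def pathfinish_def)
    then have "g 0 \<notin> ?I" "g 1 \<notin> ?I" using Jordan(9) by blast+
    moreover have "X \<inter> ?I \<subseteq> {g 0, g 1}" using XF unfolding F_eq by blast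
    ultimately show "X \<inter> ?I = {}" by auto
    show "?O \<inter> ?I = {}" "?O \<union> ?I = - C" using Jordan(8,9) by blast+
    show "J1 \<inter> J2 \<subseteq> X" using bd(6) aX by simp
  qed (fact Jordan bd gX)+
  \<comment> \<open>\<open>Fe\<close> lies on \<open>J1\<close>, and \<open>J1 - X\<close> is
    contained in \<open>side J2\<close>; hence the opposite indices here.\<close>
  define Oe where "Oe = ?O \<inter> side J2"
  define Od where "Od = ?O \<inter> side J1"
  have XC: "X \<inter> C \<subseteq> J1 \<inter> J2" using XF F_eq bd by auto
  have conO: "connected Oe" "connected Od" unfolding Oe_def Od_def
    using connected_side[OF Jordan(5,3)] bd XC by blast+
  have cover: "?O - X \<subseteq> Oe \<union> Od" using sides_cover[OF gX(3) Jordan(3)] unfolding Oe_def Od_def by blast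
  have clO: "C \<inter> side J2 \<subseteq> closure Oe" "C \<inter> side J1 \<subseteq> closure Od"
    unfolding Oe_def Od_def using open_Int_closure_subset[of "side J2" ?O]
      open_Int_closure_subset[of "side J1" ?O] bd open_side Jordan(11)
    by (auto simp: frontier_def Int_commute)
  have "Oe \<inter> side J1 = {}" "Od \<inter> side J2 = {}"
    using sides_disjoint by (auto simp: Oe_def Od_def)
  then have clO_disj: "closure Oe \<inter> side J1 = {}" "closure Od \<inter> side J2 = {}"
    using bd open_side by (metis Int_commute open_Int_closure_eq_empty)+
  have side1: "Fe - X \<subseteq> side J2" and side2: "Fd - X \<subseteq> side J1"
    using side_C bd(7,8) by blast+
  \<comment> \<open>All four corners are off \<open>X\<close>, so they can serve as passages between
    the exterior parts and the sides \<open>Fl\<close> and \<open>Fr\<close>.\<close>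
  have corner_e: "pathstart gr \<in> Fe - X" "pathfinish gl \<in> Fe - X"
    and corner_d: "pathfinish gr \<in> Fd - X" "pathstart gl \<in> Fd - X"
  proof -
    have *: "pathstart gr \<in> Fe" "pathfinish gl \<in> Fe" "pathfinish gr \<in> Fd" "pathstart gl \<in> Fd"
      using corners pathstart_in_path_image pathfinish_in_path_image by metis+
    have "Fe \<union> Fd \<subseteq> F" using F_eq C_sides by auto
    then have "(Fe \<union> Fd) \<inter> X \<subseteq> {g 0, g 1}" using XF by blast
    then have "(Fe \<union> Fd) \<inter> X = {}" using a(2) b(2) by auto
    then show "pathstart gr \<in> Fe - X" "pathfinish gl \<in> Fe - X"
       "pathfinish gr \<in> Fd - X" "pathstart gl \<in> Fd - X" using * by blast+
  qed
  have FeC: "Fe \<subseteq> C" "Fd \<subseteq> C" using C_sides by auto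
  have cl_e: "Fe - X \<subseteq> closure Oe" and cl_d: "Fd - X \<subseteq> closure Od"
    using clO side1 side2 FeC by blast+
  have "Oe \<noteq> {}" "Od \<noteq> {}"
    using corner_e(1) corner_d(1) cl_e cl_d by (metis closure_empty empty_iff subsetD)+
  then obtain x y where x: "x \<in> Oe" and y: "y \<in> Od" by blast
  define G1 where "G1 = g ` {0..1/2}"
  define G2 where "G2 = g ` {1/2..1}"
  have XG: "X = G1 \<union> G2" and Gm: "G1 \<inter> G2 = {g (1/2)}"
    using arc_initial_final_segments(1,2)[OF g(1), of "1/2"] by (simp_all add: X_def G1_def G2_def)
  have FG: "F \<inter> G1 \<subseteq> {g 0}" "F \<inter> G2 \<subseteq> {g 1}"
  proof -
    have "z = g 0" if "z \<in> F" "z \<in> G1" for z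
      using gF that unfolding G1_def by (auto; fastforce)
    then show "F \<inter> G1 \<subseteq> {g 0}" by blast
    have "z = g 1" if "z \<in> F" "z \<in> G2" for z
      using gF that unfolding G2_def by (auto; fastforce)
    then show "F \<inter> G2 \<subseteq> {g 1}" by blast
  qed
  have sub: "Fl \<subseteq> F" "Fr \<subseteq> F" using F_eq C_sides by auto
  have disj1: "A \<inter> G1 = {}" if "A \<subseteq> F" "A \<inter> Fl = {}" for A
  proof -
    have "A \<inter> G1 \<subseteq> {g 0}" "g 0 \<notin> A" using FG(1) that a(1) by auto
    then show ?thesis by auto
  qed
  have disj2: "A \<inter> G2 = {}" if "A \<subseteq> F" "A \<inter> Fr = {}" for A
  proof -
    have "A \<inter> G2 \<subseteq> {g 1}" "g 1 \<notin> A" using FG(2) that b(1) by auto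
    then show ?thesis by auto
  qed
  have G1d: "Fr \<inter> G1 = {}" "K2 \<inter> G1 = {}"
    using disj1[OF sub(2)] disj1[OF K(4)] KF(2) sides_Int(1) by auto
  have G2d: "Fl \<inter> G2 = {}" "K1 \<inter> G2 = {}"
    using disj2[OF sub(1)] disj2[OF K(3)] KF(1) sides_Int(1) by auto
  define S where "S = Fl \<union> K1 \<union> G1"
  define T where "T = Fr \<union> K2 \<union> G2"
  have ST: "S \<inter> T = {g (1/2)}"
    using Gm G1d G2d K(5) KF sides_Int(1) unfolding S_def T_def
    by (simp add: Int_Un_distrib Int_Un_distrib2 Int_commute)
  have "{0..1/2} \<subseteq> {0..1::real}" "{1/2..1} \<subseteq> {0..1::real}" by auto
  then have "continuous_on {0..1/2} g" "continuous_on {1/2..1} g"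
    using arc_imp_path[OF g(1)] unfolding path_def by (metis continuous_on_subset)+
  then have compST: "compact S" "compact T" unfolding S_def T_def G1_def G2_def
    using compact_sides K(1,2) by (auto intro!: compact_Un compact_continuous_image)
  have OX: "Oe \<inter> X = {}" "Od \<inter> X = {}" using side_disjoint by (auto simp: Oe_def Od_def)
  have OF: "Oe \<inter> F = {}" "Od \<inter> F = {}" using F_outside by (auto simp: Oe_def Od_def)
  \<comment> \<open>The chain is \<open>Oe\<close>, \<open>e\<close>, \<open>A\<close>,
    \<open>d\<close>, \<open>Od\<close>: the corners \<open>e\<close> and \<open>d\<close> lie in
    the closures of \<open>Oe\<close> and \<open>Od\<close>, so adding them keeps these connected,
    and \<open>A\<close> joins them off \<open>Z\<close>.\<close>
  have link: "connected_component (- Z) x y"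
    if Z: "Z \<subseteq> F \<union> X" "A \<inter> Z = {}" "connected A" "e \<in> A" "d \<in> A" "e \<in> Fe - X" "d \<in> Fd - X" for Z A e d
  proof -
    have "connected (insert e Oe)" "connected (insert d Od)"
      using connected_intermediate_closure[OF conO(1)] connected_intermediate_closure[OF conO(2)]
        cl_e cl_d that(6,7) by (meson closure_subset insert_subset subsetD subset_insertI)+
    then have "connected (insert e Oe \<union> A)"
      using that by (intro connected_Un) auto
    then have "connected ((insert e Oe \<union> A) \<union> insert d Od)"
      by (rule connected_Un[OF _ \<open>connected (insert d Od)\<close>]) (use that in auto)
    moreover have "(insert e Oe \<union> A) \<union> insert d Od \<subseteq> - Z"
      using that OX OF by blast
    ultimately show ?thesis
      unfolding connected_component_def using x y by blast
  qed
  have 1: "connected_component (- S) x y"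
  proof (rule link)
    show "S \<subseteq> F \<union> X" using XG K(3) sub unfolding S_def by blast
    show "Fr \<inter> S = {}" unfolding S_def using KF(1) sides_Int(1) G1d(1) by blast
    show "pathstart gr \<in> Fr" "pathfinish gr \<in> Fr" by auto
  qed (use arcs connected_arc_image corner_e corner_d in blast)+
  have 2: "connected_component (- T) x y"
  proof (rule link)
    show "T \<subseteq> F \<union> X" using XG K(4) sub unfolding T_def by blast
    show "Fl \<inter> T = {}" unfolding T_def using KF(2) sides_Int(1) G2d(1) by blast
    show "pathfinish gl \<in> Fl" "pathstart gl \<in> Fl" by auto
  qed (use arcs connected_arc_image corner_e corner_d in blast)+
  have "connected_component (- (S \<union> T)) x y"
    using 1 2 compST ST by (intro Janiszewski) (simp_all add: compact_imp_closed)
  moreover have "open (- (S \<union> T))" using compST by (intro open_Compl closed_Un compact_imp_closed)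
  ultimately have "path_component (- (S \<union> T)) x y"
    by (simp add: open_path_connected_component)
  then obtain p where p: "path p" "path_image p \<subseteq> - (S \<union> T)" "pathstart p = x" "pathfinish p = y"
    by (auto simp: path_component_def)
  have ST_eq: "S \<union> T = Fl \<union> Fr \<union> K1 \<union> K2 \<union> X" unfolding S_def T_def XG by blast
  \<comment> \<open>A point of \<open>F\<close> in the closure of the exterior is on
    \<open>C\<close>. It is not on \<open>Fd\<close>, because \<open>Fd - X\<close> lies in the open
    set \<open>side J1\<close>, which \<open>closure Oe\<close> misses; \<open>Fl\<close> and
    \<open>Fr\<close> belong to \<open>S \<union> T\<close>.\<close>
  have classify: "z \<in> Fe" if "z \<in> closure Oe" "z \<in> F" "z \<notin> S \<union> T" for z
  proof -
    have "z \<notin> Fd" using that clO_disj side2 ST_eq by blast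
    moreover have "z \<in> C"
    proof -
      have "closure Oe \<subseteq> closure ?O" unfolding Oe_def by (simp add: closure_mono)
      also have "\<dots> = ?O \<union> C" using Jordan(11) closure_Un_frontier by metis
      finally show ?thesis using that F_outside by auto
    qed
    ultimately show ?thesis using that ST_eq C_sides by auto
  qed
  have classify': "z \<in> Fd" if "z \<in> closure Od" "z \<in> F" "z \<notin> S \<union> T" for z
  proof -
    have "z \<notin> Fe" using that clO_disj side1 ST_eq by blast
    moreover have "z \<in> C"
    proof -
      have "closure Od \<subseteq> closure ?O" unfolding Od_def by (simp add: closure_mono)
      also have "\<dots> = ?O \<union> C" using Jordan(11) closure_Un_frontier by metis
      finally show ?thesis using that F_outside by auto
    qed
    ultimately show ?thesis using that ST_eq C_sides by auto
  qed
  have "path_image p \<inter> closure Oe \<inter> closure Od = {}"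
  proof (rule ccontr)
    assume "\<not> ?thesis"
    then obtain z where z: "z \<in> closure Oe" "z \<in> closure Od" "z \<notin> S \<union> T" using p by blast
    show False
    proof (cases "z \<in> F")
      case True then show False using classify classify' z sides_Int(2) by blast
    next
      case False
      then have "z \<in> Oe \<union> Od" using cover F_outside z ST_eq by auto
      then show False using z clO_disj by (auto simp: Oe_def Od_def)
    qed
  qed
  then obtain s t where st: "0 \<le> s" "s < t" "t \<le> 1" "p s \<in> closure Oe" "p t \<in> closure Od"
    "p ` {s<..<t} \<inter> (closure Oe \<union> closure Od) = {}"
    "p ` {s..t} \<subseteq> closure (p ` {s<..<t})"
    using path_last_first[of p "closure Oe" "closure Od"] p x y closure_subset[of Oe] closure_subset[of Od]
    by (metis closed_closure in_mono)
  define Q where "Q = p ` {s<..<t}"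
  define Q' where "Q' = p ` {s..t}"
  have "Q \<subseteq> Q'" unfolding Q_def Q'_def by (rule image_mono) auto
  have "Q' \<subseteq> path_image p" unfolding Q'_def path_image_def using st(1,3) by (intro image_mono) auto
  then have Q'ST: "Q' \<inter> (S \<union> T) = {}" using p(2) by blast
  \<comment> \<open>\<open>Oe\<close>, \<open>Od\<close> and \<open>X\<close> cover the exterior, so
    a piece of path missing all three stays in \<open>F\<close>; its end points follow because
    \<open>F\<close> is closed.\<close>
  have "Q \<inter> Oe = {}" "Q \<inter> Od = {}"
    using st(6) closure_subset[of Oe] closure_subset[of Od] unfolding Q_def[symmetric] by blast+
  moreover have "Q \<inter> X = {}" using \<open>Q \<subseteq> Q'\<close> Q'ST ST_eq by blast
  ultimately have "Q \<subseteq> F" using cover unfolding F_outside by blast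
  then have pF: "Q' \<subseteq> F"
    using st(7) compact_imp_closed[OF compact_F] unfolding Q_def[symmetric] Q'_def[symmetric]
    by (meson closure_minimal subset_trans)
  show thesis
  proof
    have img: "path_image (subpath s t p) = Q'"
      unfolding Q'_def using st by (simp add: path_image_subpath)
    show "path_image (subpath s t p) \<inter> (K1 \<union> K2) = {}"
      unfolding img using Q'ST ST_eq by blast
    have ends: "p s \<in> Q'" "p t \<in> Q'" unfolding Q'_def using st by auto
    have "p s \<in> Fe" by (rule classify[OF st(4)]) (use ends pF Q'ST in auto)
    moreover have "p t \<in> Fd" by (rule classify'[OF st(5)]) (use ends pF Q'ST in auto)
    ultimately show "subpath s t p \<in> intrusion_paths F Fe Fd"
      unfolding intrusion_paths_def using img pF st(1-3) p(1) by simp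
  qed
qed

end

subsection \<open>Attainment\<close>

lemma detect_le_iff:
  assumes "M \<ge> 1" "N \<ge> 1"
  shows "detect M N T R p \<le> c \<longleftrightarrow> (\<exists>i\<in>{1..M}. \<exists>j\<in>{1..N}. dist (T i) p * dist (R j) p \<le> c)"
proof -
  have "{1..M} \<times> {1..N} \<noteq> {}" using assms by auto
  then show ?thesis unfolding detect_def by (subst Min_le_iff) auto
qed

lemma detect_nonneg:
  assumes "M \<ge> 1" "N \<ge> 1"
  shows "0 \<le> detect M N T R p"
proof -
  have "{1..M} \<times> {1..N} \<noteq> {}" using assms by auto
  then show ?thesis unfolding detect_def by (subst Min_ge_iff) auto
qed

lemma closed_detect_le:
  assumes "M \<ge> 1" "N \<ge> 1"
  shows "closed {p. detect M N T R p \<le> c}"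
proof -
  have "{p. detect M N T R p \<le> c} = (\<Union>i\<in>{1..M}. \<Union>j\<in>{1..N}. {p. dist (T i) p * dist (R j) p \<le> c})"
    using detect_le_iff[OF assms] by auto
  then show ?thesis
    by (auto intro!: closed_UN closed_Collect_le continuous_intros)
qed

lemma closed_deployments_detect_le:
  assumes "M \<ge> 1" "N \<ge> 1"
  shows "closed {(T, R). \<forall>q\<in>H. detect M N T R q \<le> c}"
proof -
  have "{(T, R). \<forall>q\<in>H. detect M N T R q \<le> c} =
     (\<Inter>q\<in>H. \<Union>i\<in>{1..M}. \<Union>j\<in>{1..N}. {x. dist (fst x i) q * dist (snd x j) q \<le> c})"
    using detect_le_iff[OF assms] by fastforce
  moreover have "continuous_on UNIV (\<lambda>x::(nat \<Rightarrow> complex) \<times> (nat \<Rightarrow> complex). fst x i)"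
    "continuous_on UNIV (\<lambda>x::(nat \<Rightarrow> complex) \<times> (nat \<Rightarrow> complex). snd x i)" for i
    by (rule continuous_on_product_then_coordinatewise, intro continuous_intros)+
  ultimately show ?thesis
    by (auto intro!: closed_INT closed_UN closed_Collect_le continuous_intros)
qed

text \<open>Tychonoff's theorem. Constraining every index, not only those in use, makes this a
  compact product.\<close>

lemma compact_deployments:
  fixes H :: "complex set"
  assumes "compact H"
  shows "compact {T :: nat \<Rightarrow> complex. range T \<subseteq> H}"
proof -
  have "compactin (product_topology (\<lambda>_. euclidean) (UNIV::nat set)) (\<Pi>\<^sub>E i\<in>UNIV. H)"
    using assms by (simp add: compactin_PiE)
  moreover have "(\<Pi>\<^sub>E i\<in>UNIV. H) = {T :: nat \<Rightarrow> complex. range T \<subseteq> H}" by auto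
  ultimately show ?thesis by (simp add: euclidean_product_topology)
qed

text \<open>
  The deployments on a compact set that meet a bound
  form a closed set increasing with the bound, so compactness yields one meeting all of them.
\<close>

lemma uniform_deployment:
  fixes H :: "complex set"
  assumes MN: "M \<ge> 1" "N \<ge> 1" and "compact H"
    and ex: "\<And>c. c \<in> V \<Longrightarrow> \<exists>T R. range T \<subseteq> H \<and> range R \<subseteq> H \<and> (\<forall>q\<in>H. detect M N T R q \<le> c)"
    and "V \<noteq> {}"
  obtains T R where "range T \<subseteq> H" "range R \<subseteq> H" "\<And>q c. q \<in> H \<Longrightarrow> c \<in> V \<Longrightarrow> detect M N T R q \<le> c"
proof -
  let ?D = "{T :: nat \<Rightarrow> complex. range T \<subseteq> H} \<times> {R :: nat \<Rightarrow> complex. range R \<subseteq> H}"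
  let ?E = "\<lambda>c. {(T, R). \<forall>q\<in>H. detect M N T R q \<le> c}"
  have "?D \<inter> (\<Inter>c\<in>V. ?E c) \<noteq> {}"
  proof (rule compact_imp_fip_image)
    show "compact ?D" using compact_deployments[OF \<open>compact H\<close>] by (intro compact_Times)
    show "closed (?E c)" for c by (rule closed_deployments_detect_le[OF MN])
    fix V' assume V': "finite V'" "V' \<subseteq> V"
    \<comment> \<open>Of finitely many bounds the least one implies the others; if there are none,
      any member of \<open>V\<close> will do.\<close>
    obtain c where c: "c \<in> V" "\<And>c'. c' \<in> V' \<Longrightarrow> c \<le> c'"
    proof (cases "V' = {}")
      case True then show ?thesis using that \<open>V \<noteq> {}\<close> by auto
    next
      case False
      then have "Min V' \<in> V" using V' Min_in by blast
      then show ?thesis using that V'(1) by (meson Min_le)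
    qed
    obtain T R where "range T \<subseteq> H" "range R \<subseteq> H" "\<forall>q\<in>H. detect M N T R q \<le> c"
      using ex[OF c(1)] by blast
    then have "(T, R) \<in> ?D \<inter> (\<Inter>c\<in>V'. ?E c)" using c(2) by fastforce
    then show "?D \<inter> (\<Inter>c\<in>V'. ?E c) \<noteq> {}" by blast
  qed
  then obtain x where "x \<in> ?D \<inter> (\<Inter>c\<in>V. ?E c)" by blast
  then obtain T R where "(T, R) \<in> ?D \<inter> (\<Inter>c\<in>V. ?E c)" by (cases x) blast
  then show thesis using that[of T R] by blast
qed

text \<open>The closed sublevel sets of \<open>detect\<close> at its values on the path have the
  finite intersection property on the compact path image. A point common to all of them is a
  minimizer.\<close>

lemma path_detect_attained:
  assumes MN: "M \<ge> 1" "N \<ge> 1" and "path P"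
  obtains p where "p \<in> path_image P" "detect M N T R p \<le> path_detect M N T R P"
proof -
  have cP: "compact (path_image P)" "path_image P \<noteq> {}" using assms by (auto intro: compact_path_image)
  let ?E = "\<lambda>x. {p. detect M N T R p \<le> x}"
  let ?V = "detect M N T R ` path_image P"
  have "path_image P \<inter> (\<Inter>x\<in>?V. ?E x) \<noteq> {}"
  proof (rule compact_imp_fip_image[OF cP(1)])
    show "closed (?E x)" for x by (rule closed_detect_le[OF MN])
    fix V' assume V': "finite V'" "V' \<subseteq> ?V"
    show "path_image P \<inter> (\<Inter>x\<in>V'. ?E x) \<noteq> {}"
    proof (cases "V' = {}")
      case False
      then obtain p where "p \<in> path_image P" "Min V' = detect M N T R p"
        using V' Min_in[of V'] by blast
      moreover from this have "p \<in> (\<Inter>x\<in>V'. ?E x)"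
        using V' False by (metis (mono_tags, lifting) INT_I Min_le mem_Collect_eq)
      ultimately show ?thesis by blast
    qed (use cP in auto)
  qed
  then obtain p where p: "p \<in> path_image P" "\<And>q. q \<in> path_image P \<Longrightarrow> detect M N T R p \<le> detect M N T R q"
    by auto
  have "detect M N T R p \<le> path_detect M N T R P"
    unfolding path_detect_def using cP(2) p(2) by (rule cINF_greatest)
  with p(1) show thesis by (rule that)
qed

lemma path_detect_le:
  assumes "M \<ge> 1" "N \<ge> 1" "p \<in> path_image P"
  shows "path_detect M N T R P \<le> detect M N T R p"
  unfolding path_detect_def
  using detect_nonneg[OF assms(1,2)] assms(3) by (auto intro!: cINF_lower bdd_belowI2)

text \<open>The supremum bounds its members only if they are bounded above. The first transmitter
  and the first receiver, seen from the start of each path, give a common bound.\<close>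

lemma path_detect_le_worst_case:
  assumes MN: "M \<ge> 1" "N \<ge> 1" and "bounded F" and P: "P \<in> intrusion_paths F E D"
  shows "path_detect M N T R P \<le> worst_case F E D M N T R"
  unfolding worst_case_def
proof (rule cSUP_upper[OF P])
  obtain B where B: "\<And>p. p \<in> F \<Longrightarrow> norm p \<le> B" using \<open>bounded F\<close> by (auto simp: bounded_iff)
  have "path_detect M N T R P \<le> (norm (T 1) + B) * (norm (R 1) + B)" if "P \<in> intrusion_paths F E D" for P
  proof -
    let ?p = "pathstart P"
    have p: "?p \<in> path_image P" "norm ?p \<le> B" using that B by (auto simp: intrusion_paths_def)
    have "dist (T 1) ?p \<le> norm (T 1) + B" "dist (R 1) ?p \<le> norm (R 1) + B"
      using p(2) norm_triangle_ineq4[of "T 1" ?p] norm_triangle_ineq4[of "R 1" ?p] by (auto simp: dist_norm)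
    then have "dist (T 1) ?p * dist (R 1) ?p \<le> (norm (T 1) + B) * (norm (R 1) + B)"
      by (meson mult_mono zero_le_dist order_trans)
    then have "detect M N T R ?p \<le> (norm (T 1) + B) * (norm (R 1) + B)"
      unfolding detect_le_iff[OF MN] using MN by (intro bexI[of _ 1]) auto
    then show ?thesis using path_detect_le[OF MN p(1)] order_trans by blast
  qed
  then show "bdd_above (path_detect M N T R ` intrusion_paths F E D)" by (rule bdd_aboveI2)
qed

subsection \<open>Moving a deployment to the segment\<close>

context four_sided_region
begin

text \<open>Bounding the supremum from above by \<open>cSUP_least\<close> requires this.\<close>

lemma intrusion_paths_nonempty: "intrusion_paths F Fe Fd \<noteq> {}"
  using path_avoiding[of "{}" "{}"] by auto

text \<open>If \<open>f\<close> misses \<open>s\<close> on \<open>K\<close>, the closed halves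
  \<open>{..s}\<close> and \<open>{s..}\<close> cut \<open>K\<close> into disjoint compact parts. A
  point of the lower part on \<open>Fr\<close> would satisfy \<open>f p = s\<close>, and likewise
  for the upper part on \<open>Fl\<close>, so the extreme levels are covered too.\<close>

lemma level_attained:
  fixes f :: "complex \<Rightarrow> real"
  assumes "continuous_on F f" "\<And>p. p \<in> Fl \<Longrightarrow> f p \<le> s" "\<And>p. p \<in> Fr \<Longrightarrow> s \<le> f p"
    and K: "compact K" "K \<subseteq> F"
    and meets: "\<And>P. P \<in> intrusion_paths F Fe Fd \<Longrightarrow> path_image P \<inter> K \<noteq> {}"
  shows "\<exists>p\<in>K. f p = s"
proof (rule ccontr)
  assume no: "\<not> ?thesis"
  have cont: "continuous_on K f" using assms continuous_on_subset by blast
  have cl: "closed K" using K(1) by (rule compact_imp_closed)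
  have "closed (K \<inter> f -` {..s})" "closed (K \<inter> f -` {s..})"
    using continuous_closed_preimage[OF cont cl] by auto
  then have comp: "compact (K \<inter> f -` {..s})" "compact (K \<inter> f -` {s..})"
    using K(1) by (metis compact_Int_closed inf.left_idem)+
  have "(K \<inter> f -` {..s}) \<inter> (K \<inter> f -` {s..}) = {}" "(K \<inter> f -` {..s}) \<inter> Fr = {}"
    "(K \<inter> f -` {s..}) \<inter> Fl = {}"
    using no assms(2,3) order_antisym[of s] by fastforce+
  then obtain P where P: "P \<in> intrusion_paths F Fe Fd"
    "path_image P \<inter> ((K \<inter> f -` {..s}) \<union> (K \<inter> f -` {s..})) = {}"
    using path_avoiding[OF comp] K by blast
  moreover have "K = (K \<inter> f -` {..s}) \<union> (K \<inter> f -` {s..})" by auto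
  ultimately show False using meets by metis
qed

lemma deployment_on_segment:
  assumes MN: "M \<ge> 1" "N \<ge> 1" and ab: "a \<in> Fl" "b \<in> Fr" "dist a b = setdist Fl Fr"
  obtains T' R' where "range T' \<subseteq> closed_segment a b" "range R' \<subseteq> closed_segment a b"
    "\<And>q. q \<in> closed_segment a b \<Longrightarrow> detect M N T' R' q \<le> worst_case F Fe Fd M N T R"
proof -
  define L where "L = dist a b"
  \<comment> \<open>The distance to \<open>Fl\<close> may exceed \<open>L\<close>; truncating it
    keeps \<open>h (f p)\<close> on the segment and makes \<open>f\<close> constant on
    \<open>Fr\<close>.\<close>
  define f where "f p = min L (infdist p Fl)" for p
  \<comment> \<open>Each point \<open>p\<close> is sent to the point \<open>h (f p)\<close> of the segment; this never increases distances.\<close>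
  define h where "h s = a + (s / L) *\<^sub>R (b - a)" for s :: real
  have "a \<noteq> b" using ab sides_Int(1) by auto
  then have L: "L > 0" by (simp add: L_def)
  have fL: "0 \<le> f p" "f p \<le> L" for p using L by (auto simp: f_def infdist_nonneg)
  have f_lip: "\<bar>f p - f q\<bar> \<le> dist p q" for p q
    using infdist_triangle_abs[of p Fl q] by (auto simp: f_def min_def)
  have hH: "h s \<in> closed_segment a b" if "0 \<le> s" "s \<le> L" for s
    using that L unfolding in_segment h_def
    by (intro exI[of _ "s / L"]) (auto simp: algebra_simps)
  have h_dist: "dist (h s) (h t) = \<bar>s - t\<bar>" for s t
  proof -
    have "h s - h t = ((s - t) / L) *\<^sub>R (b - a)"
      by (simp add: h_def scaleR_diff_left[symmetric] diff_divide_distrib)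
    then have "dist (h s) (h t) = \<bar>(s - t) / L\<bar> * L"
      by (simp add: dist_norm L_def norm_minus_commute)
    then show ?thesis using L by (simp add: abs_divide)
  qed
  have h_onto: "\<exists>s. 0 \<le> s \<and> s \<le> L \<and> q = h s" if q: "q \<in> closed_segment a b" for q
  proof -
    obtain u where "0 \<le> u" "u \<le> 1" "q = (1 - u) *\<^sub>R a + u *\<^sub>R b" using q by (auto simp: in_segment)
    then show ?thesis using L
      by (intro exI[of _ "u * L"]) (auto simp: h_def algebra_simps mult_left_le_one_le)
  qed
  let ?c = "worst_case F Fe Fd M N T R"
  define K where "K = F \<inter> {p. detect M N T R p \<le> ?c}"
  have "compact K" unfolding K_def
    using compact_F closed_detect_le[OF MN] by (rule compact_Int_closed)
  have meets: "path_image P \<inter> K \<noteq> {}" if P: "P \<in> intrusion_paths F Fe Fd" for P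
  proof -
    have "path P" "path_image P \<subseteq> F" using P by (auto simp: intrusion_paths_def)
    then obtain p where "p \<in> path_image P" "detect M N T R p \<le> path_detect M N T R P"
      using path_detect_attained[OF MN] by blast
    moreover have "path_detect M N T R P \<le> ?c"
      using path_detect_le_worst_case[OF MN _ P] compact_F compact_imp_bounded by blast
    ultimately show ?thesis using \<open>path_image P \<subseteq> F\<close> by (force simp: K_def)
  qed
  have f_cont: "continuous_on F f" unfolding f_def by (intro continuous_intros)
  have fl: "f p = 0" if "p \<in> Fl" for p using that L by (simp add: f_def)
  \<comment> \<open>Here it matters that the segment has the shortest possible length.\<close>
  have fr: "f p = L" if "p \<in> Fr" for p
  proof -
    have "setdist Fl Fr \<le> dist p y" if "y \<in> Fl" for y
      using that \<open>p \<in> Fr\<close> setdist_le_dist[of y Fl p Fr] by (simp add: dist_commute)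
    then have "L \<le> infdist p Fl"
      using ab by (auto simp: L_def infdist_def intro: cINF_greatest)
    then show ?thesis by (simp add: f_def)
  qed
  show thesis
  proof
    show "range (\<lambda>i. h (f (T i))) \<subseteq> closed_segment a b" "range (\<lambda>j. h (f (R j))) \<subseteq> closed_segment a b"
      using hH fL by auto
    fix q assume "q \<in> closed_segment a b"
    then obtain s where s: "0 \<le> s" "s \<le> L" "q = h s" using h_onto by blast
    have "\<exists>p\<in>K. f p = s"
    proof (rule level_attained[OF f_cont])
      show "compact K" "K \<subseteq> F" by fact (auto simp: K_def)
    qed (use fl fr s meets in auto)
    then obtain p where p: "p \<in> K" "f p = s" by blast
    then obtain i j where ij: "i \<in> {1..M}" "j \<in> {1..N}" "dist (T i) p * dist (R j) p \<le> ?c"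
      using detect_le_iff[OF MN] by (auto simp: K_def)
    \<comment> \<open>Since \<open>q = h (f p)\<close> and \<open>h\<close> preserves distances, the
      left side is the difference of \<open>f x\<close> and \<open>f p\<close>, and \<open>f\<close>
      is 1-Lipschitz.\<close>
    have "dist (h (f x)) q \<le> dist x p" for x
      using f_lip[of x p] by (simp add: s(3) h_dist p(2)[symmetric])
    then have "dist (h (f (T i))) q * dist (h (f (R j))) q \<le> dist (T i) p * dist (R j) p"
      by (intro mult_mono) auto
    with ij show "detect M N (\<lambda>i. h (f (T i))) (\<lambda>j. h (f (R j))) q \<le> ?c"
      unfolding detect_le_iff[OF MN] by (meson order_trans)
  qed
qed

end

theorem theorem1:
  fixes gl ge gr gd :: "real \<Rightarrow> complex"
    and F Fl Fe Fr Fd H :: "complex set"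
    and a b :: complex
    and M N :: nat
  assumes "M \<ge> 1" and "N \<ge> 1"
    and "four_sided gl ge gr gd"
    and "F = region gl ge gr gd"
    and "Fl = path_image gl" and "Fe = path_image ge"
    and "Fr = path_image gr" and "Fd = path_image gd"
    and "H = closed_segment a b" and "a \<in> Fl" and "b \<in> Fr"
    and "dist a b = setdist Fl Fr"
    and "H \<subseteq> F"
  shows "(\<exists>T' R'. deployed_in H M N T' R' \<and>
            (\<forall>T R. deployed_in F M N T R \<longrightarrow>
               worst_case F Fe Fd M N T' R' \<le> worst_case F Fe Fd M N T R)) \<and>
         (\<forall>T R. deployed_in F M N T R \<longrightarrow>
            (\<exists>T' R'. deployed_in H M N T' R' \<and>
               worst_case F Fe Fd M N T' R' \<le> worst_case F Fe Fd M N T R))"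
proof -
  interpret region: four_sided_region gl ge gr gd using assms(3) by unfold_locales
  \<comment> \<open>One deployment on \<open>H\<close> that meets all these values at once gives the
    attained minimum, and with it both conjuncts.\<close>
  define V where "V = {worst_case F Fe Fd M N T R |T R. True}"
  have H: "compact H" "connected H" "a \<in> H" "b \<in> H" using assms(9) by auto
  obtain T' R' where D: "range T' \<subseteq> H" "range R' \<subseteq> H"
    and le: "\<And>q c. q \<in> H \<Longrightarrow> c \<in> V \<Longrightarrow> detect M N T' R' q \<le> c"
  proof (rule uniform_deployment[OF assms(1,2) H(1)])
    fix c assume "c \<in> V"
    then obtain T R where c: "c = worst_case F Fe Fd M N T R" by (auto simp: V_def)
    obtain T' R' where "range T' \<subseteq> H" "range R' \<subseteq> H" "\<And>q. q \<in> H \<Longrightarrow> detect M N T' R' q \<le> c"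
      using region.deployment_on_segment[OF assms(1,2), of a b T R] assms(10-12)
      unfolding c assms(4-9) by blast
    then show "\<exists>T R. range T \<subseteq> H \<and> range R \<subseteq> H \<and> (\<forall>q\<in>H. detect M N T R q \<le> c)" by blast
  qed (auto simp: V_def)
  have "worst_case F Fe Fd M N T' R' \<le> worst_case F Fe Fd M N T R" for T R
    unfolding worst_case_def[of F Fe Fd M N T' R']
  proof (rule cSUP_least)
    show "intrusion_paths F Fe Fd \<noteq> {}" using region.intrusion_paths_nonempty assms(4-8) by simp
    fix P assume P: "P \<in> intrusion_paths F Fe Fd"
    then have "path_image P \<inter> H \<noteq> {}"
      using region.crossing_continuum[of a b H P] H assms(10,11,13) unfolding assms(4-8) by blast
    then obtain q where q: "q \<in> path_image P" "q \<in> H" by blast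
    then have "detect M N T' R' q \<le> worst_case F Fe Fd M N T R" by (intro le) (auto simp: V_def)
    then show "path_detect M N T' R' P \<le> worst_case F Fe Fd M N T R"
      using path_detect_le[OF assms(1,2) q(1)] order_trans by blast
  qed
  moreover have "deployed_in H M N T' R'" using D by (auto simp: deployed_in_def)
  ultimately show ?thesis by blast
qed

end
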